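(* Planar symmetric simple random walk $S$ is approximately rotationally symmetric in the disk of radius $r=r(n)$ when $r=o(n^{3/4})$. However, for every $n^{3/4}\le r\le n$, there are points $x,x'\in\mathbb{Z}^2$ with $\|x\|_2,\|x'\|_2\in[r-3,r]$ and $$\lim_{n\to\infty}\frac{P(S_n=x)}{P(S_n=x')}\neq 1.$$ Moreover, if $r\le n$ and $n^{3/4}=o(r)$, there exist points $x,x'\in\mathbb{Z}^2$ with $\|x\|_2,\|x'\|_2\in[r-3,r]$ and $$\lim_{n\to\infty}\frac{P(S_n=x)}{P(S_n=x')}=0.$$
   Context: Planar symmetric simple random walk: $S_0=0$, $S_n=\sum_{k=1}^nX_k$ with $X_k$ independent in $\mathbb{Z}^2$ and $P(X_k=\pm e_1)=P(X_k=\pm e_2)=\frac14$, where $e_1,e_2$ is the standard basis of $\mathbb{R}^2$. $\|\cdot\|_p$ denotes the $L^p$ norm. The radius $r=r(n)$ and the points $x,x'$ depend on $n$. Definition: planar simple random walk is approximately rotationally symmetric in the disk of radius $r=r(n)$ if for all $s\le r$ and all points $x,x'\in\mathbb{Z}^2$ with $s-3\le\|x\|_2,\|x'\|_2\le s$ and such that $\|x\|_1+n$ and $\|x'\|_1+n$ are both even, we have $P(S_n=x)\sim P(S_n=x')$ as $n\to\infty$, where $f(n)\sim g(n)$ means $\lim_{n\to\infty}f(n)/g(n)=1$. *)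

theory Defs
  imports "HOL-Probability.Probability" "HOL-Library.Landau_Symbols"
begin

locale planar_srw = prob_space M for M :: "'a measure" +
  fixes X :: "nat \<Rightarrow> 'a \<Rightarrow> int \<times> int"
  assumes indep_steps: "indep_vars (\<lambda>_. count_space UNIV) X {1..}"
    and step_dist: "\<And>k v. k \<ge> 1 \<Longrightarrow> v \<in> {(1, 0), (-1, 0), (0, 1), (0, -1)} \<Longrightarrow>
      prob {\<omega> \<in> space M. X k \<omega> = v} = 1 / 4"

definition walk :: "(nat \<Rightarrow> 'a \<Rightarrow> int \<times> int) \<Rightarrow> nat \<Rightarrow> 'a \<Rightarrow> int \<times> int" where
  "walk X n \<omega> = (\<Sum>k = 1..n. X k \<omega>)"

definition walk_prob ::
    "'a measure \<Rightarrow> (nat \<Rightarrow> 'a \<Rightarrow> int \<times> int) \<Rightarrow> nat \<Rightarrow> int \<times> int \<Rightarrow> real" where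
  "walk_prob M X n x = measure M {\<omega> \<in> space M. walk X n \<omega> = x}"

definition norm1 :: "int \<times> int \<Rightarrow> int" where
  "norm1 x = \<bar>fst x\<bar> + \<bar>snd x\<bar>"

definition norm2 :: "int \<times> int \<Rightarrow> real" where
  "norm2 x = norm (real_of_int (fst x), real_of_int (snd x))"

text \<open>The parity condition selects the points that the walk can occupy at time \<open>n\<close>.\<close>

definition annulus_point :: "nat \<Rightarrow> real \<Rightarrow> int \<times> int \<Rightarrow> bool" where
  "annulus_point n s x \<longleftrightarrow> s - 3 \<le> norm2 x \<and> norm2 x \<le> s \<and> even (norm1 x + int n)"

text \<open>
  The quantities \<open>s\<close>, \<open>x\<close>, \<open>x'\<close> depend on \<open>n\<close>, so they are sequences. The limit \<open>n \<rightarrow> \<infinity>\<close> is taken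
  along the indices at which they satisfy the constraints; if these hold for all large \<open>n\<close>, this is
  the ordinary limit. Requiring the constraints for all large \<open>n\<close> instead would make the definition
  vacuous for, e.g., a radius with \<open>r n < 1\<close> for infinitely many odd \<open>n\<close>, because then
  the disk contains no point of the right parity.
\<close>

definition approx_rot_symmetric ::
    "'a measure \<Rightarrow> (nat \<Rightarrow> 'a \<Rightarrow> int \<times> int) \<Rightarrow> (nat \<Rightarrow> real) \<Rightarrow> bool" where
  "approx_rot_symmetric M X r \<longleftrightarrow>
    (\<forall>(s :: nat \<Rightarrow> real) (x :: nat \<Rightarrow> int \<times> int) (x' :: nat \<Rightarrow> int \<times> int).
      ((\<lambda>n. walk_prob M X n (x n) / walk_prob M X n (x' n)) \<longlongrightarrow> 1)
        (inf sequentially (principal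
          {n. s n \<le> r n \<and> annulus_point n (s n) (x n) \<and> annulus_point n (s n) (x' n)})))"

end

theory Submission
  imports Defs
begin

text \<open>
  In the coordinates \<open>(a + b, a - b)\<close> the two components of the walk are independent
  one-dimensional simple random walks. For the one-dimensional walk the ratio of the weights of
  \<open>w + 1\<close> and \<open>w - 1\<close> at time \<open>n\<close> is exactly \<open>(N - w) / (N + w)\<close> with
  \<open>N = n + 1\<close>, so its logarithm is \<open>- 2 artanh (w / N)\<close>. The linear part of \<open>artanh\<close>
  telescopes to \<open>- u\<^sup>2 / (2 N)\<close>; since \<open>(a + b)\<^sup>2 + (a - b)\<^sup>2 = 2 (a\<^sup>2 + b\<^sup>2)\<close>, these
  quadratic terms add up to a rotationally symmetric function. The remainder
  \<open>2 artanh t - 2 t \<approx> 2 t\<^sup>3 / 3\<close> contributes a quartic term of order \<open>s\<^sup>4 / n\<^sup>3\<close>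
  at distance \<open>s\<close>, which vanishes for \<open>s = o(n powr (3/4))\<close>. The quartic term is
  strictly larger on the diagonals than on the axes, and comparing a diagonal point with an axis
  point gives a ratio of at most \<open>exp (- c r\<^sup>4 / n\<^sup>3)\<close>.
\<close>

section \<open>Counting sign sequences by their sum\<close>

text \<open>Counts the sequences in \<open>{-1, 1} ^ n\<close> with sum \<open>u\<close>, a binomial
  coefficient. The recursion gives \<open>0\<close> out of range and for the wrong parity without
  case distinctions.\<close>

fun signed_sums :: "nat \<Rightarrow> int \<Rightarrow> real" where
  "signed_sums 0 u = (if u = 0 then 1 else 0)"
| "signed_sums (Suc n) u = signed_sums n (u - 1) + signed_sums n (u + 1)"

lemma signed_sums_nonneg: "signed_sums n u \<ge> 0"
  by (induction n arbitrary: u) auto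

lemma signed_sums_uminus: "signed_sums n (- u) = signed_sums n u"
proof (induction n arbitrary: u)
  case (Suc n)
  show ?case
    using Suc.IH[of "u + 1"] Suc.IH[of "u - 1"] by simp
qed auto

lemma signed_sums_abs: "signed_sums n \<bar>u\<bar> = signed_sums n u"
  by (simp add: abs_if signed_sums_uminus)

lemma signed_sums_eq_0: "int n < \<bar>u\<bar> \<Longrightarrow> signed_sums n u = 0"
  by (induction n arbitrary: u) auto

lemma signed_sums_pos: "\<bar>u\<bar> \<le> int n \<Longrightarrow> even (u + int n) \<Longrightarrow> signed_sums n u > 0"
proof (induction n arbitrary: u)
  case (Suc n)
  show ?case
  proof (cases "u > 0")
    case True
    then have "signed_sums n (u - 1) > 0"
      using Suc.prems by (intro Suc.IH) auto
    then show ?thesis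
      using signed_sums_nonneg[of n "u + 1"] by simp
  next
    case False
    \<comment> \<open>By parity. This matters only for \<open>n = 0\<close>, where
      \<open>u = 0\<close> would move \<open>u + 1\<close> out of range.\<close>
    have "u \<noteq> - int n" using Suc.prems by auto
    then have "signed_sums n (u + 1) > 0"
      using Suc.prems False by (intro Suc.IH) auto
    then show ?thesis
      using signed_sums_nonneg[of n "u - 1"] by simp
  qed
qed auto

text \<open>With \<open>u = 2 * k - n\<close> this is the quotient \<open>(n - k) / (k + 1)\<close>
  of neighbouring binomial coefficients, cross-multiplied so that it also holds where they vanish.
  In the induction both sides reduce to \<open>(2 * n + 2) * signed_sums n (u + 1)\<close>.\<close>

lemma signed_sums_ratio:
  "(real n + real_of_int u + 2) * signed_sums n (u + 2) = (real n - real_of_int u) * signed_sums n u"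
proof (induction n arbitrary: u)
  case (Suc n)
  have "(real n + real_of_int u + 3) * signed_sums n (u + 3) = (real n - real_of_int u - 1) * signed_sums n (u + 1)"
    using Suc.IH[of "u + 1"] by (simp add: algebra_simps)
  moreover have "(real n + real_of_int u + 1) * signed_sums n (u + 1) = (real n - real_of_int u + 1) * signed_sums n (u - 1)"
    using Suc.IH[of "u - 1"] by (simp add: algebra_simps)
  ultimately show ?case
    by (simp add: algebra_simps)
qed auto

section \<open>The law of the walk in rotated coordinates\<close>

context planar_srw
begin

lemma X_measurable: "k \<ge> 1 \<Longrightarrow> X k \<in> M \<rightarrow>\<^sub>M count_space UNIV"
  using indep_steps by (auto simp: indep_vars_def2)

lemma walk_measurable: "walk X n \<in> M \<rightarrow>\<^sub>M count_space UNIV"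
proof (induction n)
  case 0
  then show ?case by (simp add: walk_def)
next
  case (Suc n)
  have "(\<lambda>\<omega>. walk X n \<omega> + X (Suc n) \<omega>) \<in> M \<rightarrow>\<^sub>M count_space UNIV"
    by (rule measurable_compose_countable[where f = "\<lambda>i \<omega>. i + X (Suc n) \<omega>", OF _ Suc.IH])
       (rule measurable_compose[OF X_measurable], auto)
  then show ?case
    by (simp add: walk_def[abs_def])
qed

text \<open>The four given masses already add up to \<open>1\<close>, which leaves probability
  \<open>0\<close> for any other value.\<close>

lemma AE_step:
  assumes "k \<ge> 1"
  shows "AE \<omega> in M. X k \<omega> \<in> {(1, 0), (-1, 0), (0, 1), (0, -1)}"
proof -
  note [measurable] = X_measurable[OF assms]
  let ?E = "\<lambda>v. {\<omega> \<in> space M. X k \<omega> = v}"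
  let ?V = "{(1, 0), (-1, 0), (0, 1), (0, -1)} :: (int \<times> int) set"
  have "prob (\<Union>v\<in>?V. ?E v) = (\<Sum>v\<in>?V. prob (?E v))"
    by (rule finite_measure_finite_Union) (auto simp: disjoint_family_on_def)
  also have "\<dots> = (\<Sum>v\<in>?V. 1 / 4)"
    using step_dist[OF assms] by (intro sum.cong) auto
  also have "\<dots> = 1" by simp
  finally have "prob (\<Union>v\<in>?V. ?E v) = 1" .
  then have "AE \<omega> in M. \<omega> \<in> (\<Union>v\<in>?V. ?E v)"
    by (rule prob_eq_1[THEN iffD1, rotated]) auto
  then show ?thesis by eventually_elim auto
qed

lemma prob_steps:
  assumes "finite J" "J \<subseteq> {1..}" "\<And>j. j \<in> J \<Longrightarrow> v j \<in> {(1, 0), (-1, 0), (0, 1), (0, -1)}"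
  shows "prob {\<omega> \<in> space M. \<forall>j\<in>J. X j \<omega> = v j} = (1 / 4) ^ card J"
proof (cases "J = {}")
  case False
  have "prob (\<Inter>j\<in>J. X j -` {v j} \<inter> space M) = (\<Prod>j\<in>J. prob (X j -` {v j} \<inter> space M))"
    using indep_steps False assms(1,2) unfolding indep_vars_def2
    by (intro indep_setsD[where I = "{1..}"]) auto
  also have "\<dots> = (\<Prod>j\<in>J. 1 / 4)"
  proof (rule prod.cong[OF refl])
    fix j assume j: "j \<in> J"
    have "X j -` {v j} \<inter> space M = {\<omega> \<in> space M. X j \<omega> = v j}" by auto
    then show "prob (X j -` {v j} \<inter> space M) = 1 / 4"
      using step_dist[of j "v j"] assms(2) assms(3)[OF j] j by auto
  qed
  also have "(\<Inter>j\<in>J. X j -` {v j} \<inter> space M) = {\<omega> \<in> space M. \<forall>j\<in>J. X j \<omega> = v j}"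
    using False by auto
  finally show ?thesis by simp
qed (simp add: prob_space)

text \<open>Carrying finitely many future steps \<open>J\<close> along makes the induction on \<open>n\<close> work
  without a separate proof that the walk is independent of its next step.\<close>

lemma prob_walk_and_steps:
  assumes "finite J" "J \<subseteq> {Suc n..}" "\<And>j. j \<in> J \<Longrightarrow> v j \<in> {(1, 0), (-1, 0), (0, 1), (0, -1)}"
  shows "prob {\<omega> \<in> space M. walk X n \<omega> = (a, b) \<and> (\<forall>j\<in>J. X j \<omega> = v j)} =
    signed_sums n (a + b) * signed_sums n (a - b) / 4 ^ n * (1 / 4) ^ card J"
  using assms
proof (induction n arbitrary: a b J v)
  case 0
  show ?case
  proof (cases "a = 0 \<and> b = 0")
    case True
    then show ?thesis
      using prob_steps[of J v] 0 by (simp add: walk_def zero_prod_def)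
  next
    case False
    then show ?thesis
      by (auto simp: walk_def zero_prod_def)
  qed
next
  case (Suc n)
  let ?V = "{(1, 0), (-1, 0), (0, 1), (0, -1)} :: (int \<times> int) set"
  \<comment> \<open>\<open>?E w\<close> fixes step \<open>Suc n\<close> to be \<open>w\<close>; this
    step joins the future steps \<open>J\<close>, so the induction hypothesis covers the
    event.\<close>
  let ?E = "\<lambda>w. {\<omega> \<in> space M. walk X n \<omega> = (a, b) - w \<and>
    (\<forall>j\<in>insert (Suc n) J. X j \<omega> = (v(Suc n := w)) j)}"
  let ?F = "{\<omega> \<in> space M. walk X (Suc n) \<omega> = (a, b) \<and> (\<forall>j\<in>J. X j \<omega> = v j)}"
  note [measurable] = walk_measurable
  have [measurable]: "X j \<in> M \<rightarrow>\<^sub>M count_space UNIV" if "j \<in> insert (Suc n) J" for j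
    using Suc.prems(2) that by (intro X_measurable) auto
  have notin: "Suc n \<notin> J" using Suc.prems(2) by auto
  have Suc_n: "1 \<le> Suc n" by simp
  have walk_Suc: "walk X (Suc n) \<omega> = walk X n \<omega> + X (Suc n) \<omega>" for \<omega>
    by (simp add: walk_def)
  have E_eq: "?E w = {\<omega> \<in> ?F. X (Suc n) \<omega> = w}" for w
  proof -
    have "walk X n \<omega> = (a, b) - w \<and> X (Suc n) \<omega> = w \<longleftrightarrow>
      walk X (Suc n) \<omega> = (a, b) \<and> X (Suc n) \<omega> = w" for \<omega>
      unfolding walk_Suc eq_diff_eq by metis
    moreover have "(\<forall>j\<in>insert (Suc n) J. X j \<omega> = (v(Suc n := w)) j) \<longleftrightarrow>
      X (Suc n) \<omega> = w \<and> (\<forall>j\<in>J. X j \<omega> = v j)" for \<omega>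
      using notin by auto
    ultimately show ?thesis by blast
  qed
  have E_meas: "?E w \<in> events" for w
    using Suc.prems(1) by measurable
  have F_meas: "?F \<in> events"
    using Suc.prems(1) by measurable
  have "prob ?F = prob (\<Union>w\<in>?V. ?E w)"
  proof (rule finite_measure_eq_AE)
    show "AE \<omega> in M. \<omega> \<in> ?F \<longleftrightarrow> \<omega> \<in> (\<Union>w\<in>?V. ?E w)"
      using AE_step[OF Suc_n] unfolding E_eq by eventually_elim blast
  qed (use E_meas F_meas in auto)
  also have "\<dots> = (\<Sum>w\<in>?V. prob (?E w))"
    by (rule finite_measure_finite_Union) (use E_meas in \<open>auto simp: disjoint_family_on_def\<close>)
  also have "\<dots> = (\<Sum>w\<in>?V. signed_sums n (a + b - (fst w + snd w)) *
      signed_sums n (a - b - (fst w - snd w)) / 4 ^ n * (1 / 4) ^ Suc (card J))"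
  proof (rule sum.cong[OF refl])
    fix w assume w: "w \<in> ?V"
    have "prob {\<omega> \<in> space M. walk X n \<omega> = (a - fst w, b - snd w) \<and>
        (\<forall>j\<in>insert (Suc n) J. X j \<omega> = (v(Suc n := w)) j)} =
      signed_sums n (a - fst w + (b - snd w)) * signed_sums n (a - fst w - (b - snd w)) / 4 ^ n *
      (1 / 4) ^ card (insert (Suc n) J)"
      using Suc.prems w by (intro Suc.IH) (auto split: if_splits)
    moreover have "a - fst w + (b - snd w) = a + b - (fst w + snd w)"
      "a - fst w - (b - snd w) = a - b - (fst w - snd w)" by simp_all
    ultimately show "prob (?E w) = signed_sums n (a + b - (fst w + snd w)) *
      signed_sums n (a - b - (fst w - snd w)) / 4 ^ n * (1 / 4) ^ Suc (card J)"
      using notin Suc.prems(1) by (simp only: minus_prod_def card_insert_disjoint fst_conv snd_conv not_False_eq_True)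
  qed
  \<comment> \<open>The pair \<open>(fst w + snd w, fst w - snd w)\<close> runs through all four
    pairs of signs, so the sum factors into the two recursions.\<close>
  also have "\<dots> = signed_sums (Suc n) (a + b) * signed_sums (Suc n) (a - b) / 4 ^ Suc n * (1 / 4) ^ card J"
    by (simp add: ring_distribs add_divide_distrib)
  finally show ?case .
qed

text \<open>Since \<open>4 ^ n = 2 ^ n * 2 ^ n\<close>, this is the product of two one-dimensional
  laws.\<close>

lemma walk_prob_eq:
  "walk_prob M X n (a, b) = signed_sums n (a + b) * signed_sums n (a - b) / 4 ^ n"
  using prob_walk_and_steps[of "{}" n undefined a b] by (simp add: walk_prob_def)

end

section \<open>Cubic bounds for the nonlinear part of artanh\<close>

definition artanh_excess :: "real \<Rightarrow> real" where
  "artanh_excess t = 2 * artanh t - 2 * t"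

lemma artanh_excess_0 [simp]: "artanh_excess 0 = 0"
  by (simp add: artanh_excess_def)

lemma artanh_excess_deriv:
  assumes "\<bar>t\<bar> < 1"
  shows "(artanh_excess has_real_derivative 2 * t\<^sup>2 / (1 - t\<^sup>2)) (at t)"
proof -
  have "t\<^sup>2 < 1" using assms by (simp add: abs_square_less_1)
  then show ?thesis
    unfolding artanh_excess_def[abs_def]
    by (auto intro!: derivative_eq_intros assms simp: field_simps)
qed

text \<open>The power series has nonnegative coefficients and starts at degree 3, so scaling by
  \<open>l\<close> gains at least \<open>l ^ 3\<close>. The proof compares derivatives in
  \<open>t\<close>.\<close>

lemma artanh_excess_scale_le:
  assumes "0 \<le> l" "l \<le> 1" "0 \<le> t" "t < 1"
  shows "artanh_excess (l * t) \<le> l ^ 3 * artanh_excess t"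
proof -
  define h where "h = (\<lambda>y. l ^ 3 * artanh_excess y - artanh_excess (l * y))"
  have "h 0 \<le> h t"
  proof (rule DERIV_nonneg_imp_nondecreasing[OF assms(3)])
    fix y assume y: "0 \<le> y" "y \<le> t"
    then have y1: "\<bar>y\<bar> < 1" using assms by auto
    have "\<bar>l * y\<bar> \<le> 1 * \<bar>y\<bar>"
      unfolding abs_mult using assms by (intro mult_right_mono) auto
    then have ly: "\<bar>l * y\<bar> < 1" and sq: "(l * y)\<^sup>2 \<le> y\<^sup>2" "y\<^sup>2 < 1"
      using y1 by (linarith, simp_all only: abs_le_square_iff abs_square_less_1 mult_1)
    have "(h has_real_derivative l ^ 3 * (2 * y\<^sup>2 / (1 - y\<^sup>2)) - 2 * (l * y)\<^sup>2 / (1 - (l * y)\<^sup>2) * l) (at y)"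
      unfolding h_def using y1 ly
      by (auto intro!: derivative_eq_intros artanh_excess_deriv
          DERIV_chain2[where f = artanh_excess and g = "\<lambda>y. l * y"])
    moreover have "2 * (l * y)\<^sup>2 / (1 - (l * y)\<^sup>2) * l \<le> l ^ 3 * (2 * y\<^sup>2 / (1 - y\<^sup>2))"
    proof -
      have "2 * (l * y)\<^sup>2 / (1 - (l * y)\<^sup>2) * l = (l ^ 3 * (2 * y\<^sup>2)) / (1 - (l * y)\<^sup>2)"
        by (simp add: power_mult_distrib power2_eq_square power3_eq_cube)
      also have "\<dots> \<le> (l ^ 3 * (2 * y\<^sup>2)) / (1 - y\<^sup>2)"
        using sq assms by (intro divide_left_mono) auto
      finally show ?thesis by simp
    qed
    ultimately show "\<exists>d. (h has_real_derivative d) (at y) \<and> d \<ge> 0"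
      by (intro exI conjI) auto
  qed
  then show ?thesis by (simp add: h_def)
qed

lemma artanh_excess_ge:
  assumes "0 \<le> t" "t < 1"
  shows "2 / 3 * t ^ 3 \<le> artanh_excess t"
proof -
  define h where "h = (\<lambda>y. artanh_excess y - 2 / 3 * y ^ 3)"
  have "h 0 \<le> h t"
  proof (rule DERIV_nonneg_imp_nondecreasing[OF assms(1)])
    fix y assume y: "0 \<le> y" "y \<le> t"
    then have y1: "\<bar>y\<bar> < 1" using assms by auto
    then have sq: "y\<^sup>2 < 1" by (simp add: abs_square_less_1)
    have "(h has_real_derivative 2 * y\<^sup>2 / (1 - y\<^sup>2) - 2 * y\<^sup>2) (at y)"
      unfolding h_def using y1
      by (auto intro!: derivative_eq_intros artanh_excess_deriv simp: power2_eq_square)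
    moreover have "2 * y\<^sup>2 / 1 \<le> 2 * y\<^sup>2 / (1 - y\<^sup>2)"
      using sq by (intro divide_left_mono) auto
    ultimately show "\<exists>d. (h has_real_derivative d) (at y) \<and> d \<ge> 0"
      by (intro exI conjI) auto
  qed
  then show ?thesis by (simp add: h_def)
qed

lemma artanh_excess_nonneg:
  assumes "0 \<le> t" "t < 1"
  shows "0 \<le> artanh_excess t"
  using order_trans[OF _ artanh_excess_ge[OF assms]] assms by simp

text \<open>Scaling down from \<open>1 / 2\<close> by the factor \<open>2 * t\<close>; the value
  there is \<open>ln 3 - 1\<close>, at most \<open>1\<close>, and \<open>8\<close> is
  \<open>2 ^ 3\<close>.\<close>

lemma artanh_excess_le:
  assumes "0 \<le> t" "t \<le> 1 / 2"
  shows "artanh_excess t \<le> 8 * t ^ 3"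
proof -
  have "ln (3 :: real) \<le> 2"
    using ln_le_minus_one[of "3 :: real"] by simp
  then have "artanh_excess (1 / 2) \<le> 1"
    by (simp add: artanh_excess_def artanh_def)
  have "artanh_excess (2 * t * (1 / 2)) \<le> (2 * t) ^ 3 * artanh_excess (1 / 2)"
    using assms by (intro artanh_excess_scale_le) auto
  also have "\<dots> \<le> (2 * t) ^ 3 * 1"
    using assms \<open>artanh_excess (1 / 2) \<le> 1\<close> by (intro mult_left_mono) auto
  finally show ?thesis by (simp add: power_mult_distrib)
qed

section \<open>Logarithms of the one-dimensional counts\<close>

text \<open>The path from \<open>n mod 2\<close>, the least nonnegative value of the right parity,
  to \<open>2 * J + n mod 2\<close> in steps of 2; the arguments are the midpoints of these steps
  divided by \<open>n + 1\<close>.\<close>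

definition excess_sum :: "nat \<Rightarrow> nat \<Rightarrow> real" where
  "excess_sum n J = (\<Sum>j<J. artanh_excess (real (2 * j + n mod 2 + 1) / real (n + 1)))"

lemma ln_signed_sums:
  assumes "2 * J + n mod 2 \<le> n"
  shows "ln (signed_sums n (int (2 * J + n mod 2))) =
    ln (signed_sums n (int (n mod 2))) + real (n mod 2) ^ 2 / (2 * real (n + 1))
    - real (2 * J + n mod 2) ^ 2 / (2 * real (n + 1)) - excess_sum n J"
  using assms
proof (induction J)
  case (Suc J)
  let ?u = "2 * J + n mod 2" and ?N = "real (n + 1)"
  define t where "t = real (?u + 1) / ?N"
  have par: "even (int ?u + int n)"
    by (cases "even n") (simp_all add: odd_iff_mod_2_eq_one)
  have u: "?u + 2 \<le> n" using Suc.prems by simp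
  have pos: "signed_sums n (int ?u) > 0" "signed_sums n (int ?u + 2) > 0"
    using u par by (auto intro!: signed_sums_pos)
  have t: "0 < t" "t < 1"
    using u by (auto simp: t_def)
  define A D where "A = real n + real ?u + 2" and "D = real n - real ?u"
  have "A * signed_sums n (int ?u + 2) = D * signed_sums n (int ?u)"
    using signed_sums_ratio[of n "int ?u"] by (simp add: A_def D_def)
  moreover have "A > 0" "D > 0"
    using u by (auto simp: A_def D_def)
  ultimately have "signed_sums n (int ?u + 2) = signed_sums n (int ?u) / (A / D)"
    by (simp add: eq_divide_eq mult.commute)
  \<comment> \<open>Using the midpoint \<open>?u + 1\<close> and \<open>?N = n + 1\<close> makes the
    ratio symmetric in \<open>t\<close>, hence an artanh.\<close>
  also have "A / D = (1 + t) / (1 - t)"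
  proof -
    have "1 + t = A / ?N" "1 - t = D / ?N"
      by (simp_all add: t_def A_def D_def field_simps)
    then show ?thesis by simp
  qed
  finally have "ln (signed_sums n (int ?u + 2)) = ln (signed_sums n (int ?u)) - ln ((1 + t) / (1 - t))"
    using pos t by (simp add: ln_div del: divide_divide_eq_right)
  also have "ln ((1 + t) / (1 - t)) = 2 * t + artanh_excess t"
    by (simp add: artanh_excess_def artanh_def)
  finally have "ln (signed_sums n (int ?u + 2)) =
    ln (signed_sums n (int ?u)) - 2 * t - artanh_excess t" by simp
  \<comment> \<open>The linear part telescopes as a difference of squares.\<close>
  moreover have "2 * t + real ?u ^ 2 / (2 * ?N) = real (?u + 2) ^ 2 / (2 * ?N)"
  proof -
    have "2 * ((y + 1) / N) + y\<^sup>2 / (2 * N) = (y + 2)\<^sup>2 / (2 * N)" if "N > 0" for y N :: real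
      using that by (simp add: field_simps power2_eq_square)
    from this[of ?N "real ?u"] show ?thesis
      by (simp add: t_def add_ac)
  qed
  moreover have "int (2 * Suc J + n mod 2) = int ?u + 2" "2 * Suc J + n mod 2 = ?u + 2"
    by simp_all
  moreover have "excess_sum n (Suc J) = excess_sum n J + artanh_excess t"
    by (simp add: excess_sum_def t_def)
  ultimately show ?case
    using Suc.IH u by (simp only:)
qed (simp add: excess_sum_def)

text \<open>Telescoping with \<open>(w + 1) ^ 4 - (w - 1) ^ 4 = 8 * w ^ 3 + 8 * w\<close>.\<close>

lemma sum_cubes_le:
  "(\<Sum>j<J. real (2 * j + p + 1) ^ 3) \<le> real (2 * J + p) ^ 4 / 8"
proof (induction J)
  case (Suc J)
  define w where "w = real (2 * J + p + 1)"
  have "w \<ge> 0" by (simp add: w_def)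
  then have "w ^ 3 \<le> (w + 1) ^ 4 / 8 - (w - 1) ^ 4 / 8"
    by (simp add: power4_eq_xxxx power3_eq_cube field_simps)
  moreover have "w + 1 = real (2 * Suc J + p)" "w - 1 = real (2 * J + p)"
    by (simp_all add: w_def)
  ultimately show ?case
    using Suc by (simp add: w_def)
qed auto

lemma excess_sum_nonneg: "2 * J + n mod 2 \<le> n \<Longrightarrow> 0 \<le> excess_sum n J"
  unfolding excess_sum_def by (intro sum_nonneg artanh_excess_nonneg) auto

text \<open>The assumption keeps every argument at most \<open>1 / 2\<close>, the range of
  \<open>artanh_excess_le\<close>; the \<open>8\<close> there cancels the \<open>1 / 8\<close> from
  the sum of cubes.\<close>

lemma excess_sum_le:
  assumes "2 * (2 * J + n mod 2) \<le> n"
  shows "excess_sum n J \<le> real (2 * J + n mod 2) ^ 4 / real (n + 1) ^ 3"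
proof -
  have "excess_sum n J \<le> (\<Sum>j<J. 8 * (real (2 * j + n mod 2 + 1) / real (n + 1)) ^ 3)"
    unfolding excess_sum_def
    using assms by (intro sum_mono artanh_excess_le) (auto simp: divide_le_eq)
  also have "\<dots> = 8 / real (n + 1) ^ 3 * (\<Sum>j<J. real (2 * j + n mod 2 + 1) ^ 3)"
    by (simp add: sum_distrib_left power_divide)
  also have "\<dots> \<le> 8 / real (n + 1) ^ 3 * (real (2 * J + n mod 2) ^ 4 / 8)"
    by (intro mult_left_mono sum_cubes_le) auto
  finally show ?thesis by simp
qed

text \<open>An axis point has both rotated coordinates of size \<open>a\<close>, a point by the
  diagonal only one large one, \<open>2 * K + n mod 2\<close>. The left over terms from
  \<open>J\<close> to \<open>K\<close> are each at least the value at \<open>a\<close>, and the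
  second copy of \<open>excess_sum n J\<close> costs at most \<open>a / 8\<close> such
  values.\<close>

lemma excess_sum_gap:
  assumes "J \<le> K" "2 * K + n mod 2 \<le> n" "2 * J + n mod 2 > 0"
  defines "a \<equiv> real (2 * J + n mod 2)"
  shows "(real K - real J - a / 8) * artanh_excess (a / real (n + 1)) \<le> excess_sum n K - 2 * excess_sum n J"
proof -
  let ?N = "real (n + 1)"
  let ?g = "artanh_excess (a / ?N)"
  let ?w = "\<lambda>j. real (2 * j + n mod 2 + 1)"
  have a: "a > 0" "a / ?N < 1" "a / ?N \<ge> 0"
    using assms by (auto simp: a_def divide_less_eq)
  have g: "?g \<ge> 0" using a by (intro artanh_excess_nonneg)
  (* cubic homogeneity: the sum of (w / a)^3 over the J summands is at most a / 8 *)
  have upper: "excess_sum n J \<le> a / 8 * ?g"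
  proof -
    have "excess_sum n J \<le> (\<Sum>j<J. (?w j / a) ^ 3 * ?g)"
      unfolding excess_sum_def
    proof (rule sum_mono)
      fix j assume j: "j \<in> {..<J}"
      have "artanh_excess (?w j / a * (a / ?N)) \<le> (?w j / a) ^ 3 * ?g"
        using a j by (intro artanh_excess_scale_le) (auto simp: a_def divide_le_eq)
      then show "artanh_excess (?w j / ?N) \<le> (?w j / a) ^ 3 * ?g"
        using a by simp
    qed
    also have "\<dots> = (\<Sum>j<J. ?w j ^ 3) * (?g / a ^ 3)"
      by (simp add: sum_distrib_right sum_divide_distrib power_divide)
    also have "\<dots> \<le> (a ^ 4 / 8) * (?g / a ^ 3)"
      unfolding a_def using g a by (intro mult_right_mono sum_cubes_le) (auto simp: a_def)
    also have "\<dots> = a / 8 * ?g"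
      using a by (simp add: field_simps eval_nat_numeral)
    finally show ?thesis .
  qed
  have "real (K - J) * ?g \<le> (\<Sum>j=J..<K. artanh_excess (?w j / ?N))"
  proof -
    have "?g \<le> artanh_excess (?w j / ?N)" if j: "j \<in> {J..<K}" for j
    proof -
      have w: "?w j / ?N < 1" "0 \<le> ?w j / ?N" "a \<le> ?w j" "?w j > 0"
        using j assms(2) by (auto simp: divide_less_eq a_def)
      \<comment> \<open>Monotonicity, obtained from scaling by \<open>a / ?w j\<close>, which is at
        most \<open>1\<close>.\<close>
      have "artanh_excess (a / ?w j * (?w j / ?N)) \<le> (a / ?w j) ^ 3 * artanh_excess (?w j / ?N)"
        using w a by (intro artanh_excess_scale_le) (auto simp: divide_le_eq)
      also have "\<dots> \<le> 1 * artanh_excess (?w j / ?N)"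
        using w a by (intro mult_right_mono artanh_excess_nonneg power_le_one) auto
      finally show ?thesis using w by simp
    qed
    then have "(\<Sum>j=J..<K. ?g) \<le> (\<Sum>j=J..<K. artanh_excess (?w j / ?N))"
      by (intro sum_mono)
    then show ?thesis by simp
  qed
  also have "\<dots> = excess_sum n K - excess_sum n J"
    unfolding excess_sum_def lessThan_atLeast0 using assms(1)
    by (simp add: sum_diff_nat_ivl)
  finally show ?thesis
    using upper assms(1) by (simp add: of_nat_diff algebra_simps)
qed

section \<open>Logarithm of the walk probability\<close>

lemma parity_decomp:
  assumes "even (u + int n)"
  obtains J where "\<bar>u\<bar> = int (2 * J + n mod 2)"
proof
  have "even (\<bar>u\<bar> - int (n mod 2))"
    using assms by (cases "even n") (auto simp: odd_iff_mod_2_eq_one)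
  moreover have "\<bar>u\<bar> - int (n mod 2) \<ge> 0"
    using assms by (cases "even n") (auto simp: odd_iff_mod_2_eq_one)
  ultimately show "\<bar>u\<bar> = int (2 * nat ((\<bar>u\<bar> - int (n mod 2)) div 2) + n mod 2)"
    by simp
qed

lemma norm2_sq: "(norm2 (a, b))\<^sup>2 = real_of_int a ^ 2 + real_of_int b ^ 2"
  by (simp add: norm2_def norm_Pair)

lemma norm2_nonneg: "norm2 x \<ge> 0"
  by (simp add: norm2_def)

text \<open>Collects what depends on \<open>n\<close> alone, so that it cancels in ratios.\<close>

definition ln_walk_const :: "nat \<Rightarrow> real" where
  "ln_walk_const n = 2 * (ln (signed_sums n (int (n mod 2))) + real (n mod 2) ^ 2 / (2 * real (n + 1)))
    - ln (4 ^ n)"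

text \<open>Only the two excess sums depend on the direction of the point.\<close>

lemma (in planar_srw) ln_walk_prob:
  assumes J: "\<bar>a + b\<bar> = int (2 * J + n mod 2)" "2 * J + n mod 2 \<le> n"
    and K: "\<bar>a - b\<bar> = int (2 * K + n mod 2)" "2 * K + n mod 2 \<le> n"
  shows "walk_prob M X n (a, b) > 0"
    and "ln (walk_prob M X n (a, b)) =
      ln_walk_const n - (norm2 (a, b))\<^sup>2 / real (n + 1) - excess_sum n J - excess_sum n K"
proof -
  let ?u = "2 * J + n mod 2" and ?v = "2 * K + n mod 2"
  have P: "walk_prob M X n (a, b) = signed_sums n (int ?u) * signed_sums n (int ?v) / 4 ^ n"
    unfolding walk_prob_eq J(1)[symmetric] K(1)[symmetric] signed_sums_abs ..
  have par: "even (int (2 * J + n mod 2) + int n)" for J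
    by (cases "even n") (simp_all add: odd_iff_mod_2_eq_one)
  have pos: "signed_sums n (int ?u) > 0" "signed_sums n (int ?v) > 0"
    using J(2) K(2) par by (auto intro!: signed_sums_pos simp del: of_nat_add)
  then show "walk_prob M X n (a, b) > 0"
    unfolding P by simp
  have "real ?u = \<bar>real_of_int (a + b)\<bar>" "real ?v = \<bar>real_of_int (a - b)\<bar>"
    using J(1) K(1) by linarith+
  then have "real ?u ^ 2 + real ?v ^ 2 = 2 * (norm2 (a, b))\<^sup>2"
    unfolding norm2_sq by (simp add: power2_eq_square algebra_simps)
  then have "(norm2 (a, b))\<^sup>2 / real (n + 1) = real ?u ^ 2 / (2 * real (n + 1)) + real ?v ^ 2 / (2 * real (n + 1))"
    by (simp add: add_divide_distrib[symmetric] del: of_nat_add of_nat_Suc)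
  moreover have "ln (walk_prob M X n (a, b)) = ln (signed_sums n (int ?u)) + ln (signed_sums n (int ?v)) - ln (4 ^ n)"
    unfolding P using pos by (simp add: ln_mult ln_div del: of_nat_add)
  ultimately show "ln (walk_prob M X n (a, b)) =
      ln_walk_const n - (norm2 (a, b))\<^sup>2 / real (n + 1) - excess_sum n J - excess_sum n K"
    unfolding ln_signed_sums[OF J(2)] ln_signed_sums[OF K(2)] ln_walk_const_def by argo
qed

text \<open>The squares of the rotated coordinates add up to at most \<open>2 * s ^ 2\<close>. So
  each coordinate is at most \<open>2 * s\<close>, hence at most \<open>n / 2\<close>, and its
  fourth power is at most \<open>4 * s ^ 4\<close>; two excess sums give the
  \<open>8\<close>.\<close>

lemma (in planar_srw) ln_walk_prob_bounds:
  assumes x: "annulus_point n s x" and s: "4 * s \<le> real n"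
  shows "walk_prob M X n x > 0"
    and "ln (walk_prob M X n x) \<le> ln_walk_const n - (norm2 x)\<^sup>2 / real (n + 1)"
    and "ln_walk_const n - (norm2 x)\<^sup>2 / real (n + 1) - 8 * s ^ 4 / real (n + 1) ^ 3
      \<le> ln (walk_prob M X n x)"
proof -
  obtain a b where ab: "x = (a, b)" by (cases x)
  have par: "even (a + b + int n)" "even (a - b + int n)"
    using x by (auto simp: annulus_point_def norm1_def ab)
  obtain J where J: "\<bar>a + b\<bar> = int (2 * J + n mod 2)"
    using parity_decomp[OF par(1)] .
  obtain K where K: "\<bar>a - b\<bar> = int (2 * K + n mod 2)"
    using parity_decomp[OF par(2)] .
  have norm: "norm2 x \<le> s" "0 \<le> s"
    using x norm2_nonneg[of x] by (auto simp: annulus_point_def)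
  then have sq: "real_of_int a ^ 2 + real_of_int b ^ 2 \<le> s\<^sup>2"
    using norm2_sq[of a b] power_mono[OF norm(1) norm2_nonneg, of 2] by (simp add: ab)
  have bound: "2 * L \<le> n \<and> real L ^ 4 \<le> 4 * s ^ 4" if "real L ^ 2 \<le> 2 * s\<^sup>2" for L :: nat
  proof
    have "(2 * s)\<^sup>2 = 4 * s\<^sup>2" by (simp add: power_mult_distrib)
    then have "real L ^ 2 \<le> (2 * s)\<^sup>2" using that zero_le_power2[of s] by linarith
    then have "real L \<le> 2 * s"
      by (rule power2_le_imp_le) (use norm(2) in simp)
    then show "2 * L \<le> n" using s by linarith
    have "(real L ^ 2) ^ 2 \<le> (2 * s\<^sup>2) ^ 2"
      using that by (intro power_mono) auto
    then show "real L ^ 4 \<le> 4 * s ^ 4"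
      by (simp add: power_mult_distrib flip: power_mult)
  qed
  have "real (2 * J + n mod 2) = \<bar>real_of_int (a + b)\<bar>" "real (2 * K + n mod 2) = \<bar>real_of_int (a - b)\<bar>"
    using J K by linarith+
  then have "real (2 * J + n mod 2) ^ 2 + real (2 * K + n mod 2) ^ 2 =
      2 * (real_of_int a ^ 2 + real_of_int b ^ 2)"
    by (simp add: power2_eq_square algebra_simps)
  then have uv: "real (2 * J + n mod 2) ^ 2 \<le> 2 * s\<^sup>2" "real (2 * K + n mod 2) ^ 2 \<le> 2 * s\<^sup>2"
    using sq zero_le_power2[of "real (2 * J + n mod 2)"] zero_le_power2[of "real (2 * K + n mod 2)"]
    by (argo, argo)
  note bJ = bound[OF uv(1)] and bK = bound[OF uv(2)]
  have le: "2 * J + n mod 2 \<le> n" "2 * K + n mod 2 \<le> n"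
    using bJ bK by auto
  have eJ: "excess_sum n J \<le> 4 * s ^ 4 / real (n + 1) ^ 3"
    by (rule order_trans[OF excess_sum_le divide_right_mono]) (use bJ in auto)
  have eK: "excess_sum n K \<le> 4 * s ^ 4 / real (n + 1) ^ 3"
    by (rule order_trans[OF excess_sum_le divide_right_mono]) (use bK in auto)
  note L = ln_walk_prob[OF J le(1) K le(2), folded ab]
  show "walk_prob M X n x > 0" by (rule L(1))
  show "ln (walk_prob M X n x) \<le> ln_walk_const n - (norm2 x)\<^sup>2 / real (n + 1)"
    using L(2) excess_sum_nonneg[OF le(1)] excess_sum_nonneg[OF le(2)] by linarith
  have "8 * s ^ 4 / real (n + 1) ^ 3 = 4 * s ^ 4 / real (n + 1) ^ 3 + 4 * s ^ 4 / real (n + 1) ^ 3"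
    by (simp add: add_divide_distrib[symmetric])
  then show "ln_walk_const n - (norm2 x)\<^sup>2 / real (n + 1) - 8 * s ^ 4 / real (n + 1) ^ 3
      \<le> ln (walk_prob M X n x)"
    using L(2) eJ eK by linarith
qed

section \<open>Rotational symmetry below the threshold\<close>

text \<open>Norms differing by at most 3 and of sum at most \<open>2 * s\<close> give the
  \<open>6 * s\<close>. In each direction the excess of only one point counts, so the
  \<open>8\<close> is not doubled.\<close>

lemma (in planar_srw) abs_ln_walk_prob_ratio_le:
  assumes x: "annulus_point n s x" and x': "annulus_point n s x'" and s: "4 * s \<le> real n"
  shows "\<bar>ln (walk_prob M X n x / walk_prob M X n x')\<bar> \<le>
    6 * s / real (n + 1) + 8 * s ^ 4 / real (n + 1) ^ 3"
proof -
  let ?N = "real (n + 1)"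
  have b: "norm2 x \<le> s" "s - 3 \<le> norm2 x" "norm2 x' \<le> s" "s - 3 \<le> norm2 x'"
    using x x' by (auto simp: annulus_point_def)
  have "\<bar>(norm2 x)\<^sup>2 - (norm2 x')\<^sup>2\<bar> = \<bar>norm2 x - norm2 x'\<bar> * (norm2 x + norm2 x')"
    using norm2_nonneg[of x] norm2_nonneg[of x']
    by (simp add: power2_eq_square square_diff_square_factored abs_mult)
  also have "\<dots> \<le> 3 * (2 * s)"
    using b norm2_nonneg[of x] norm2_nonneg[of x'] by (intro mult_mono) auto
  finally have "\<bar>(norm2 x)\<^sup>2 - (norm2 x')\<^sup>2\<bar> / ?N \<le> 6 * s / ?N"
    by (intro divide_right_mono) auto
  then have "\<bar>(norm2 x)\<^sup>2 / ?N - (norm2 x')\<^sup>2 / ?N\<bar> \<le> 6 * s / ?N"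
    by (simp add: diff_divide_distrib[symmetric])
  moreover have "ln (walk_prob M X n x / walk_prob M X n x') = ln (walk_prob M X n x) - ln (walk_prob M X n x')"
    using ln_walk_prob_bounds(1)[OF x s] ln_walk_prob_bounds(1)[OF x' s] by (simp add: ln_div)
  ultimately show ?thesis
    using ln_walk_prob_bounds(2,3)[OF x s] ln_walk_prob_bounds(2,3)[OF x' s] by linarith
qed

lemma (in planar_srw) approx_rot_symmetric_smallo:
  assumes r: "r \<in> o(\<lambda>n. real n powr (3/4))"
  shows "approx_rot_symmetric M X r"
  unfolding approx_rot_symmetric_def
proof (intro allI)
  fix s :: "nat \<Rightarrow> real" and x x' :: "nat \<Rightarrow> int \<times> int"
  let ?A = "{n. s n \<le> r n \<and> annulus_point n (s n) (x n) \<and> annulus_point n (s n) (x' n)}"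
  let ?F = "inf sequentially (principal ?A)"
  let ?R = "\<lambda>n. walk_prob M X n (x n) / walk_prob M X n (x' n)"
  define q where "q = (\<lambda>n. r n / real n powr (3/4))"
  have q: "q \<longlonglongrightarrow> 0"
    unfolding q_def by (rule smalloD_tendsto[OF r])
  \<comment> \<open>This secures \<open>4 * s n \<le> n\<close> on \<open>?A\<close>, as the
    estimates require.\<close>
  have q1: "eventually (\<lambda>n. \<bar>q n\<bar> < 1 / 4) sequentially"
    using tendstoD[OF q, of "1/4"] by (simp add: dist_real_def)
  have bound: "eventually (\<lambda>n. \<bar>ln (?R n)\<bar> \<le> 6 * \<bar>q n\<bar> + 8 * q n ^ 4 \<and> ?R n > 0) ?F"
    unfolding eventually_inf_principal
    using q1 eventually_gt_at_top[of 0]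
  proof eventually_elim
    case (elim n)
    show ?case
    proof
      assume "n \<in> ?A"
      then have s: "s n \<le> r n" and x: "annulus_point n (s n) (x n)" and x': "annulus_point n (s n) (x' n)"
        by auto
      have s0: "0 \<le> s n"
        using x norm2_nonneg[of "x n"] by (auto simp: annulus_point_def)
      have n: "real n \<ge> 1" using elim(2) by simp
      have p: "real n powr (3/4) > 0" "real n powr (3/4) \<le> real n"
        using n powr_mono[of "3/4" 1 "real n"] by auto
      have p4: "(real n powr (3/4)) ^ 4 = real n ^ 3"
        using n by (simp add: powr_power)
      have rq: "r n = q n * real n powr (3/4)" using p by (simp add: q_def)
      then have "0 \<le> q n * real n powr (3/4)" using s s0 by linarith
      then have q0: "q n \<ge> 0" using p by (simp add: zero_le_mult_iff)
      have rn: "r n \<le> q n * real n"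
        unfolding rq using q0 p by (intro mult_left_mono)
      also have "\<dots> \<le> 1 / 4 * real n"
        using elim(1) by (intro mult_right_mono) auto
      finally have s4: "4 * s n \<le> real n" using s by linarith
      have "s n \<le> q n * real (n + 1)"
        using s rn q0 by (simp add: algebra_simps)
      then have "6 * s n / real (n + 1) \<le> 6 * \<bar>q n\<bar>"
        using q0 by (simp add: divide_le_eq)
      moreover have "8 * s n ^ 4 / real (n + 1) ^ 3 \<le> 8 * q n ^ 4"
      proof -
        have "s n ^ 4 \<le> (q n * real n powr (3/4)) ^ 4"
          using s s0 rq by (intro power_mono) auto
        also have "\<dots> = q n ^ 4 * real n ^ 3"
          by (simp add: power_mult_distrib p4)
        also have "\<dots> \<le> q n ^ 4 * real (n + 1) ^ 3"
          by (intro mult_left_mono power_mono) auto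
        finally show ?thesis by (simp add: divide_le_eq)
      qed
      ultimately show "\<bar>ln (?R n)\<bar> \<le> 6 * \<bar>q n\<bar> + 8 * q n ^ 4 \<and> ?R n > 0"
        using abs_ln_walk_prob_ratio_le[OF x x' s4] ln_walk_prob_bounds(1)[OF x s4]
          ln_walk_prob_bounds(1)[OF x' s4] by auto
    qed
  qed
  have "((\<lambda>n. 6 * \<bar>q n\<bar> + 8 * q n ^ 4) \<longlongrightarrow> 6 * \<bar>0\<bar> + 8 * 0 ^ 4) sequentially"
    by (intro tendsto_intros q)
  then have "((\<lambda>n. 6 * \<bar>q n\<bar> + 8 * q n ^ 4) \<longlongrightarrow> 0) ?F"
    by (intro tendsto_mono[OF inf_le1]) simp
  then have "((\<lambda>n. ln (?R n)) \<longlongrightarrow> 0) ?F"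
    by (rule Lim_null_comparison[rotated]) (use bound in \<open>auto elim: eventually_mono\<close>)
  then have "((\<lambda>n. exp (ln (?R n))) \<longlongrightarrow> exp 0) ?F"
    by (rule tendsto_exp)
  moreover have "eventually (\<lambda>n. exp (ln (?R n)) = ?R n) ?F"
    using bound by eventually_elim auto
  ultimately show "(?R \<longlongrightarrow> 1) ?F"
    by (simp add: tendsto_cong)
qed

section \<open>Asymmetry from the threshold on\<close>

text \<open>The unlikely point lies next to the diagonal and the likely one on the axis. The gap of the
  quartic terms is positive because \<open>1 / sqrt 2 - 1 / 2 > 1 / 8\<close>, the constants in
  \<open>excess_sum_gap\<close>. The third assumption makes it dominate the error \<open>6 r / n\<close> that comes from the
  width of the annulus.\<close>

lemma (in planar_srw) walk_prob_disparity:
  assumes r: "r \<le> real n" "1000 \<le> r" "46080 * real n ^ 2 \<le> r ^ 3"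
  shows "\<exists>x x'. annulus_point n r x \<and> annulus_point n r x' \<and> walk_prob M X n x' > 0 \<and>
    walk_prob M X n x / walk_prob M X n x' \<le> exp (- (r ^ 4 / (7680 * real n ^ 3)))"
proof -
  let ?p = "n mod 2" and ?N = "real (n + 1)"
  have n: "real n \<ge> 1" using r by linarith
  \<comment> \<open>The largest integer up to \<open>r\<close> with the parity of
    \<open>n\<close>.\<close>
  define a where "a = (if even (nat \<lfloor>r\<rfloor> + n) then nat \<lfloor>r\<rfloor> else nat \<lfloor>r\<rfloor> - 1)"
  have a: "r - 2 \<le> real a" "real a \<le> r"
    using r(2) unfolding a_def by (auto, linarith+)
  have a_even: "even (a + n)"
    using r(2) unfolding a_def by auto
  have a_n: "a \<le> n" using a r by linarith
  obtain J where J: "\<bar>int a\<bar> = int (2 * J + ?p)"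
    using parity_decomp[of "int a" n] a_even by (metis even_of_nat of_nat_add)
  have aJ: "2 * J + ?p = a" using J by linarith
  \<comment> \<open>Subtracting 1 keeps \<open>(d + ?p, d)\<close> in the disk, where
    \<open>?p\<close> corrects the parity. The total loss of 2 per coordinate costs
    \<open>2 * sqrt 2 < 3\<close> in the norm.\<close>
  define d where "d = nat \<lfloor>r / sqrt 2\<rfloor> - 1"
  have sqrt2: "7 / 5 \<le> sqrt 2" "sqrt 2 \<le> 10 / 7"
    by (rule real_le_rsqrt real_le_lsqrt; simp add: power2_eq_square)+
  have r2: "7 / 10 * r \<le> r / sqrt 2"
  proof -
    have "7 / 10 * r * sqrt 2 \<le> 7 / 10 * r * (10 / 7)"
      using sqrt2 r by (intro mult_left_mono) auto
    then show ?thesis by (simp add: le_divide_eq)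
  qed
  have d: "real d \<le> r / sqrt 2 - 1" "r / sqrt 2 - 2 \<le> real d"
    using r2 r(2) unfolding d_def by linarith+
  let ?x = "(int d + int ?p, int d)" and ?x' = "(int a, 0 :: int)"
  have x': "annulus_point n r ?x'"
    using a a_even by (auto simp: annulus_point_def norm2_def norm1_def)
  have nx_sq: "(norm2 ?x)\<^sup>2 = (real d + real ?p)\<^sup>2 + real d ^ 2"
    by (simp add: norm2_sq)
  have nx_le: "norm2 ?x \<le> r"
  proof (rule power2_le_imp_le)
    have "(norm2 ?x)\<^sup>2 \<le> (real d + 1)\<^sup>2 + (real d + 1)\<^sup>2"
      unfolding nx_sq by (intro add_mono power_mono) auto
    also have "\<dots> \<le> (r / sqrt 2)\<^sup>2 + (r / sqrt 2)\<^sup>2"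
      using d by (intro add_mono power_mono) auto
    also have "\<dots> = r\<^sup>2" by (simp add: power_divide)
    finally show "(norm2 ?x)\<^sup>2 \<le> r\<^sup>2" .
  qed (use r in auto)
  have nx_ge: "r - 3 \<le> norm2 ?x"
  proof (rule power2_le_imp_le)
    have "r - 3 \<le> sqrt 2 * (r / sqrt 2 - 2)"
      using sqrt2 by (simp add: algebra_simps)
    also have "\<dots> \<le> sqrt 2 * real d"
      using d by (intro mult_left_mono) auto
    finally have "(r - 3)\<^sup>2 \<le> (sqrt 2 * real d)\<^sup>2"
      using r by (intro power_mono) auto
    also have "\<dots> = real d ^ 2 + real d ^ 2" by (simp add: power_mult_distrib)
    also have "\<dots> \<le> (norm2 ?x)\<^sup>2"
      unfolding nx_sq by (intro add_mono power_mono) auto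
    finally show "(r - 3)\<^sup>2 \<le> (norm2 ?x)\<^sup>2" .
  qed (rule norm2_nonneg)
  have "even (norm1 ?x + int n)"
    by (cases "even n") (auto simp: norm1_def odd_iff_mod_2_eq_one)
  then have x: "annulus_point n r ?x"
    using nx_le nx_ge by (simp add: annulus_point_def)
  have sum_a: "\<bar>int a + 0\<bar> = int (2 * J + ?p)" "\<bar>int a - 0\<bar> = int (2 * J + ?p)"
    using J by simp_all
  have J_n: "2 * J + ?p \<le> n" using aJ a_n by simp
  note P' = ln_walk_prob[OF sum_a(1) J_n sum_a(2) J_n]
  have "walk_prob M X n ?x / walk_prob M X n ?x' \<le> exp (- (r ^ 4 / (7680 * real n ^ 3)))"
  proof (cases "2 * d + ?p \<le> n")
    \<comment> \<open>The walk cannot reach \<open>?x\<close> in \<open>n\<close> steps, so the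
      ratio is \<open>0\<close>.\<close>
    case False
    then have "signed_sums n (int d + int ?p + int d) = 0"
      by (intro signed_sums_eq_0) linarith
    then show ?thesis by (simp add: walk_prob_eq)
  next
    case True
    have sum_x: "\<bar>int d + int ?p + int d\<bar> = int (2 * d + ?p)" "\<bar>int d + int ?p - int d\<bar> = int (2 * 0 + ?p)"
      by simp_all
    have "2 * 0 + ?p \<le> n" by simp
    note P = ln_walk_prob[OF sum_x(1) True sum_x(2) this]
    have "excess_sum n 0 = 0" by (simp add: excess_sum_def)
    then have ln_eq: "ln (walk_prob M X n ?x / walk_prob M X n ?x') =
        ((norm2 ?x')\<^sup>2 - (norm2 ?x)\<^sup>2) / ?N - (excess_sum n d - 2 * excess_sum n J)"
      using P P' by (simp add: ln_div diff_divide_distrib)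
    have aJ': "real a = real (2 * J + ?p)" using aJ by simp
    \<comment> \<open>Here \<open>7/10\<close> exceeds \<open>1/2 + 1/8 + 1/20\<close> by
      \<open>1/40\<close>, and \<open>r / 40\<close> absorbs the rounding loss 2.\<close>
    have Jd: "real a / 20 \<le> real d - real J - real a / 8"
      using d r2 a r(2) aJ by linarith
    have gap: "real a ^ 4 / (30 * ?N ^ 3) \<le> excess_sum n d - 2 * excess_sum n J"
    proof -
      have aN: "0 \<le> real a / ?N" "real a / ?N < 1"
        using a_n by (auto simp: divide_less_eq)
      have "real a ^ 4 / (30 * ?N ^ 3) = real a / 20 * (2 / 3 * (real a / ?N) ^ 3)"
        by (simp add: power_divide eval_nat_numeral)
      also have "\<dots> \<le> (real d - real J - real a / 8) * artanh_excess (real a / ?N)"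
        using Jd aN by (intro mult_mono artanh_excess_ge) auto
      also have "\<dots> \<le> excess_sum n d - 2 * excess_sum n J"
        unfolding aJ' using Jd True a r(2) aJ by (intro excess_sum_gap) linarith+
      finally show ?thesis .
    qed
    have quad: "((norm2 ?x')\<^sup>2 - (norm2 ?x)\<^sup>2) / ?N \<le> 6 * r / real n"
    proof -
      have "(norm2 ?x')\<^sup>2 \<le> r\<^sup>2" "(r - 3)\<^sup>2 \<le> (norm2 ?x)\<^sup>2"
        using x' nx_ge r norm2_nonneg[of ?x'] by (auto intro!: power_mono simp: annulus_point_def)
      then have "(norm2 ?x')\<^sup>2 - (norm2 ?x)\<^sup>2 \<le> 6 * r"
        by (simp add: power2_eq_square algebra_simps)
      then have "((norm2 ?x')\<^sup>2 - (norm2 ?x)\<^sup>2) / ?N \<le> 6 * r / ?N"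
        by (intro divide_right_mono) auto
      also have "\<dots> \<le> 6 * r / real n"
        using r n by (intro divide_left_mono) auto
      finally show ?thesis .
    qed
    \<comment> \<open>\<open>46080 = 6 * 7680\<close>.\<close>
    have "6 * r / real n = (46080 * real n ^ 2) * (r / (7680 * real n ^ 3))"
      using n by (simp add: field_simps eval_nat_numeral)
    also have "\<dots> \<le> r ^ 3 * (r / (7680 * real n ^ 3))"
      using r by (intro mult_right_mono) auto
    also have "\<dots> = r ^ 4 / (7680 * real n ^ 3)"
      by (simp add: eval_nat_numeral)
    finally have err: "6 * r / real n \<le> r ^ 4 / (7680 * real n ^ 3)" .
    \<comment> \<open>From \<open>r / 2 \<le> a\<close> and \<open>?N \<le> 2 * n\<close>:
      \<open>16 * 30 * 8 = 7680 / 2\<close>. One of the two copies pays for \<open>err\<close>, the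
      other remains.\<close>
    have "2 * (r ^ 4 / (7680 * real n ^ 3)) = (r / 2) ^ 4 / (30 * (2 * real n) ^ 3)"
      by (simp add: power_divide power_mult_distrib)
    also have "\<dots> \<le> real a ^ 4 / (30 * ?N ^ 3)"
      using a r n by (intro frac_le mult_left_mono power_mono) auto
    finally have main: "2 * (r ^ 4 / (7680 * real n ^ 3)) \<le> real a ^ 4 / (30 * ?N ^ 3)" .
    have "ln (walk_prob M X n ?x / walk_prob M X n ?x') \<le> - (r ^ 4 / (7680 * real n ^ 3))"
      using ln_eq gap quad err main by linarith
    then show ?thesis
      using P(1) P'(1) by (metis divide_pos_pos exp_le_cancel_iff exp_ln)
  qed
  then show ?thesis using x x' P'(1) by blast
qed

lemma (in planar_srw) eventually_walk_prob_disparity: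
  assumes "eventually (\<lambda>n. real n powr (3/4) \<le> r n \<and> r n \<le> real n) sequentially"
  obtains x x' where
    "eventually (\<lambda>n. annulus_point n (r n) (x n) \<and> annulus_point n (r n) (x' n) \<and>
      walk_prob M X n (x' n) > 0) sequentially"
    "eventually (\<lambda>n. walk_prob M X n (x n) / walk_prob M X n (x' n) \<le>
      exp (- ((r n / real n powr (3/4)) ^ 4 / 7680))) sequentially"
proof -
  let ?Q = "\<lambda>n x x'. annulus_point n (r n) x \<and> annulus_point n (r n) x' \<and> walk_prob M X n x' > 0 \<and>
    walk_prob M X n x / walk_prob M X n x' \<le> exp (- ((r n / real n powr (3/4)) ^ 4 / 7680))"
  have ex: "eventually (\<lambda>n. \<exists>x x'. ?Q n x x') sequentially"
    \<comment> \<open>Then \<open>m = n powr (1/4)\<close> is at least \<open>46080\<close>, and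
      \<open>r ^ 3 \<ge> m ^ 9 = m * n ^ 2\<close>.\<close>
    using assms eventually_ge_at_top[of "46080 ^ 4 :: nat"]
  proof eventually_elim
    case (elim n)
    define m where "m = real n powr (1/4)"
    have n0: "real n > 0" using elim(2) by simp
    have m4: "m ^ 4 = real n"
      using n0 by (simp add: m_def powr_power)
    have m3: "m ^ 3 = real n powr (3/4)"
      using n0 by (simp add: m_def powr_power)
    have "(46080 :: real) ^ 4 \<le> m ^ 4"
      unfolding m4 using elim(2) by (metis of_nat_le_iff of_nat_numeral of_nat_power)
    then have m: "46080 \<le> m"
      using power_strict_mono[of m 46080 4] by (force simp: m_def not_less[symmetric])
    have rm: "m ^ 3 \<le> r n" using elim(1) m3 by simp
    have "m \<le> m ^ 3"
      using m by (intro self_le_power) auto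
    then have r1: "1000 \<le> r n"
      using rm m by linarith
    have r2: "46080 * real n ^ 2 \<le> r n ^ 3"
    proof -
      have "46080 * real n ^ 2 \<le> m * (m ^ 4) ^ 2"
        unfolding m4 using m by (intro mult_right_mono) auto
      also have "\<dots> = (m ^ 3) ^ 3"
        by (simp flip: power_mult power_Suc)
      also have "\<dots> \<le> r n ^ 3"
        using rm m by (intro power_mono) auto
      finally show ?thesis .
    qed
    have exponent: "(r n / real n powr (3/4)) ^ 4 / 7680 = r n ^ 4 / (7680 * real n ^ 3)"
    proof -
      have "(m ^ 3) ^ 4 = real n ^ 3"
        by (simp flip: m4 power_mult)
      then show ?thesis
        by (simp add: power_divide m3)
    qed
    show ?case
      unfolding exponent using elim(1) r1 r2 by (intro walk_prob_disparity) auto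
  qed
  define x where "x = (\<lambda>n. SOME y. \<exists>x'. ?Q n y x')"
  define x' where "x' = (\<lambda>n. SOME y. ?Q n (x n) y)"
  have "eventually (\<lambda>n. ?Q n (x n) (x' n)) sequentially"
    using ex
  proof eventually_elim
    case (elim n)
    then have "\<exists>y. ?Q n (x n) y"
      unfolding x_def by (rule someI_ex)
    then show ?case
      unfolding x'_def by (rule someI_ex)
  qed
  then show ?thesis
    by (intro that[of x x']; eventually_elim) blast+
qed

section \<open>The three ranges of the radius\<close>

theorem corollary2p1:
  fixes M :: "'a measure" and X :: "nat \<Rightarrow> 'a \<Rightarrow> int \<times> int"
  assumes "planar_srw M X"
  shows
    "(\<forall>r :: nat \<Rightarrow> real. r \<in> o(\<lambda>n. real n powr (3/4)) \<longrightarrow> approx_rot_symmetric M X r) \<and>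
     (\<forall>r :: nat \<Rightarrow> real.
        (\<forall>\<^sub>F n in sequentially. real n powr (3/4) \<le> r n \<and> r n \<le> real n) \<longrightarrow>
        (\<exists>x x'. (\<forall>\<^sub>F n in sequentially. annulus_point n (r n) (x n) \<and> annulus_point n (r n) (x' n) \<and>
                  walk_prob M X n (x' n) > 0) \<and>
           (\<forall>\<phi> :: nat \<Rightarrow> nat. strict_mono \<phi> \<longrightarrow>
              \<not> (\<lambda>k. walk_prob M X (\<phi> k) (x (\<phi> k)) / walk_prob M X (\<phi> k) (x' (\<phi> k)))
                   \<longlonglongrightarrow> 1))) \<and>
     (\<forall>r :: nat \<Rightarrow> real.
        (\<forall>\<^sub>F n in sequentially. 0 \<le> r n \<and> r n \<le> real n) \<and> (\<lambda>n. real n powr (3/4)) \<in> o(r) \<longrightarrow>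
        (\<exists>x x'. (\<forall>\<^sub>F n in sequentially. annulus_point n (r n) (x n) \<and> annulus_point n (r n) (x' n) \<and>
                  walk_prob M X n (x' n) > 0) \<and>
           (\<lambda>n. walk_prob M X n (x n) / walk_prob M X n (x' n)) \<longlonglongrightarrow> 0))"
proof -
  interpret planar_srw M X by fact
  show ?thesis
  proof (intro conjI allI impI)
    fix r :: "nat \<Rightarrow> real"
    assume "r \<in> o(\<lambda>n. real n powr (3/4))"
    then show "approx_rot_symmetric M X r"
      by (rule approx_rot_symmetric_smallo)
  next
    fix r :: "nat \<Rightarrow> real"
    assume r: "\<forall>\<^sub>F n in sequentially. real n powr (3/4) \<le> r n \<and> r n \<le> real n"
    obtain x x' where ann: "\<forall>\<^sub>F n in sequentially. annulus_point n (r n) (x n) \<and>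
        annulus_point n (r n) (x' n) \<and> walk_prob M X n (x' n) > 0"
      and ratio: "\<forall>\<^sub>F n in sequentially. walk_prob M X n (x n) / walk_prob M X n (x' n) \<le>
        exp (- ((r n / real n powr (3/4)) ^ 4 / 7680))"
      by (rule eventually_walk_prob_disparity[OF r])
    \<comment> \<open>A bound below \<open>1\<close> for all large \<open>n\<close> excludes the
      limit \<open>1\<close> along every subsequence.\<close>
    have bound: "\<forall>\<^sub>F n in sequentially. walk_prob M X n (x n) / walk_prob M X n (x' n) \<le> exp (- (1 / 7680))"
      using r ratio eventually_gt_at_top[of 0]
    proof eventually_elim
      case (elim n)
      have "1 \<le> r n / real n powr (3/4)"
        using elim by (simp add: le_divide_eq)
      then have "1 \<le> (r n / real n powr (3/4)) ^ 4"
        by (rule one_le_power)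
      then have "exp (- ((r n / real n powr (3/4)) ^ 4 / 7680)) \<le> exp (- (1 / 7680))"
        by simp
      then show ?case using elim(2) by linarith
    qed
    have "\<not> (\<lambda>k. walk_prob M X (\<phi> k) (x (\<phi> k)) / walk_prob M X (\<phi> k) (x' (\<phi> k))) \<longlonglongrightarrow> 1"
      if \<phi>: "strict_mono \<phi>" for \<phi> :: "nat \<Rightarrow> nat"
    proof
      assume lim: "(\<lambda>k. walk_prob M X (\<phi> k) (x (\<phi> k)) / walk_prob M X (\<phi> k) (x' (\<phi> k))) \<longlonglongrightarrow> 1"
      have "\<forall>\<^sub>F k in sequentially.
          walk_prob M X (\<phi> k) (x (\<phi> k)) / walk_prob M X (\<phi> k) (x' (\<phi> k)) \<le> exp (- (1 / 7680))"
        by (rule eventually_compose_filterlim[OF bound filterlim_subseq[OF \<phi>]])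
      then have "1 \<le> exp (- (1 / 7680) :: real)"
        by (rule tendsto_upperbound[OF lim]) simp
      then show False by simp
    qed
    with ann show "\<exists>x x'. (\<forall>\<^sub>F n in sequentially. annulus_point n (r n) (x n) \<and>
        annulus_point n (r n) (x' n) \<and> walk_prob M X n (x' n) > 0) \<and>
      (\<forall>\<phi> :: nat \<Rightarrow> nat. strict_mono \<phi> \<longrightarrow>
        \<not> (\<lambda>k. walk_prob M X (\<phi> k) (x (\<phi> k)) / walk_prob M X (\<phi> k) (x' (\<phi> k))) \<longlonglongrightarrow> 1)"
      by blast
  next
    fix r :: "nat \<Rightarrow> real"
    assume "(\<forall>\<^sub>F n in sequentially. 0 \<le> r n \<and> r n \<le> real n) \<and> (\<lambda>n. real n powr (3/4)) \<in> o(r)"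
    then have r: "\<forall>\<^sub>F n in sequentially. 0 \<le> r n \<and> r n \<le> real n"
      and small: "(\<lambda>n. real n powr (3/4)) \<in> o(r)" by auto
    have large: "\<forall>\<^sub>F n in sequentially. C \<le> r n / real n powr (3/4)" if "C > 0" for C
    proof -
      \<comment> \<open>The constant \<open>1 / C\<close> in the little-o condition, solved for
        \<open>r n\<close>; \<open>0 \<le> r n\<close> removes the absolute value.\<close>
      have "1 / C > 0" using that by simp
      from landau_o.smallD[OF small this] r eventually_gt_at_top[of 0] show ?thesis
        by eventually_elim (use that in \<open>simp add: field_simps\<close>)
    qed
    have "\<forall>\<^sub>F n in sequentially. real n powr (3/4) \<le> r n \<and> r n \<le> real n"
      using large[OF zero_less_one] r eventually_gt_at_top[of 0]
      by eventually_elim (simp add: le_divide_eq)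
    then obtain x x' where ann: "\<forall>\<^sub>F n in sequentially. annulus_point n (r n) (x n) \<and>
        annulus_point n (r n) (x' n) \<and> walk_prob M X n (x' n) > 0"
      and ratio: "\<forall>\<^sub>F n in sequentially. walk_prob M X n (x n) / walk_prob M X n (x' n) \<le>
        exp (- ((r n / real n powr (3/4)) ^ 4 / 7680))"
      by (rule eventually_walk_prob_disparity)
    have "filterlim (\<lambda>n. r n / real n powr (3/4)) at_top sequentially"
      unfolding filterlim_at_top_gt[where c = 0] using large by blast
    then have "filterlim (\<lambda>n. (r n / real n powr (3/4)) ^ 4 * (1 / 7680)) at_top sequentially"
      by (intro filterlim_at_top_mult_tendsto_pos[OF tendsto_const] filterlim_pow_at_top) auto
    then have lim: "((\<lambda>n. exp (- ((r n / real n powr (3/4)) ^ 4 / 7680))) \<longlongrightarrow> 0) sequentially"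
      by (intro filterlim_compose[OF exp_at_bot]) (simp add: filterlim_uminus_at_top)
    have "(\<lambda>n. walk_prob M X n (x n) / walk_prob M X n (x' n)) \<longlonglongrightarrow> 0"
      by (rule tendsto_sandwich[OF _ ratio tendsto_const lim]) (simp add: walk_prob_def)
    with ann show "\<exists>x x'. (\<forall>\<^sub>F n in sequentially. annulus_point n (r n) (x n) \<and>
        annulus_point n (r n) (x' n) \<and> walk_prob M X n (x' n) > 0) \<and>
      (\<lambda>n. walk_prob M X n (x n) / walk_prob M X n (x' n)) \<longlonglongrightarrow> 0"
      by blast
  qed
qed

end
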